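(* Let $(X,d)$ be a proper geodesic metric space. If $(X,d)$ admits a proper and cobounded coarse action by a discrete group $\Gamma$, then the bounded fixed set $X^G_{bd}$ (with respect to the restricted coarse action) exists for any finite subgroup $G\subset\Gamma$.
   Context: A metric space is proper if its closed bounded subsets are compact. A map $f\colon X\to Y$ of metric spaces is an $(L,C)$-quasi-isometry ($L,C>0$) if $\frac1L d_X(x_1,x_2)-C\le d_Y(f(x_1),f(x_2))\le L\,d_X(x_1,x_2)+C$ for all $x_1,x_2$ and every point of $Y$ is within $C$ of $f(X)$. A discrete group $\Gamma$ acts coarsely on $(X,d)$ if there are constants $L,C>0$ and a map $\Gamma\times X\to X$, $(g,x)\mapsto gx$, such that each $x\mapsto gx$ is an $(L,C)$-quasi-isometry of $X$, $ex=x$ for all $x$, and $d(g(hx),(gh)x)\le C$ for all $g,h\in\Gamma$, $x\in X$. Writing $N_R$ for the $R$-neighbourhood, the coarse action is cobounded if there is $R>0$ such that $N_R(\Gamma\cdot x)=X$ for each $x\in X$; it is proper if for each $R>0$ there is $M>0$ such that for all $x,y\in X$, $\#\{g\in\Gamma\mid g\cdot N_R(x)\cap N_R(y)\ne\emptyset\}\le M$. A (not necessarily continuous) map is coarse if preimages of bounded sets are bounded and for every $R>0$ there is $S_R>0$ with $d(x_1,x_2)\le R\Rightarrow d(f(x_1),f(x_2))\le S_R$. It is a coarse equivalence if there is a coarse map in the other direction such that both composites are at uniformly bounded distance from the identity maps. For $k\ge 0$, $X^G_k=\{x\in X\mid d(x,gx)\le k\ \forall g\in G\}$ with the induced metric.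 The bounded fixed set exists if there are $k_0>0$ and a subspace $Y\subset X^G_{k_0}$ such that the inclusion $Y\to X^G_k$ is a coarse equivalence for all $k\ge k_0$; then $X^G_{bd}=Y$. *)

theory Defs
  imports "HOL-Analysis.Analysis" "HOL-Algebra.Group"
begin

text \<open>
  A metric space is a pair of a carrier set and a distance function satisfying
  \<^locale>\<open>Metric_space\<close>; a subspace with the induced metric is a subset of the carrier with
  the same distance function.
\<close>

definition proper_metric_space :: "'a set \<Rightarrow> ('a \<Rightarrow> 'a \<Rightarrow> real) \<Rightarrow> bool" where
  "proper_metric_space X d \<longleftrightarrow>
     Metric_space X d \<and>
     (\<forall>S. closedin (Metric_space.mtopology X d) S \<and> Metric_space.mbounded X d S
          \<longrightarrow> compactin (Metric_space.mtopology X d) S)"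

text \<open>Any two points are joined by an isometrically embedded interval.\<close>

definition geodesic_metric_space :: "'a set \<Rightarrow> ('a \<Rightarrow> 'a \<Rightarrow> real) \<Rightarrow> bool" where
  "geodesic_metric_space X d \<longleftrightarrow>
     Metric_space X d \<and>
     (\<forall>x\<in>X. \<forall>y\<in>X. \<exists>\<gamma>. \<gamma> \<in> {0..d x y} \<rightarrow> X \<and> \<gamma> 0 = x \<and> \<gamma> (d x y) = y \<and>
        (\<forall>s\<in>{0..d x y}. \<forall>t\<in>{0..d x y}. d (\<gamma> s) (\<gamma> t) = \<bar>s - t\<bar>))"

definition quasi_isometry ::
  "real \<Rightarrow> real \<Rightarrow> 'a set \<Rightarrow> ('a \<Rightarrow> 'a \<Rightarrow> real) \<Rightarrow> 'b set \<Rightarrow> ('b \<Rightarrow> 'b \<Rightarrow> real) \<Rightarrow> ('a \<Rightarrow> 'b) \<Rightarrow> bool" where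
  "quasi_isometry L C X dX Y dY f \<longleftrightarrow>
     f \<in> X \<rightarrow> Y \<and>
     (\<forall>x1\<in>X. \<forall>x2\<in>X. (1 / L) * dX x1 x2 - C \<le> dY (f x1) (f x2) \<and>
                      dY (f x1) (f x2) \<le> L * dX x1 x2 + C) \<and>
     (\<forall>y\<in>Y. \<exists>x\<in>X. dY y (f x) \<le> C)"

definition coarse_action ::
  "('g, 'm) monoid_scheme \<Rightarrow> 'a set \<Rightarrow> ('a \<Rightarrow> 'a \<Rightarrow> real) \<Rightarrow> ('g \<Rightarrow> 'a \<Rightarrow> 'a) \<Rightarrow> bool" where
  "coarse_action \<Gamma> X d act \<longleftrightarrow>
     (\<exists>L C. L > 0 \<and> C > 0 \<and>
        (\<forall>g\<in>carrier \<Gamma>. quasi_isometry L C X d X d (act g)) \<and>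
        (\<forall>x\<in>X. act \<one>\<^bsub>\<Gamma>\<^esub> x = x) \<and>
        (\<forall>g\<in>carrier \<Gamma>. \<forall>h\<in>carrier \<Gamma>. \<forall>x\<in>X.
           d (act g (act h x)) (act (g \<otimes>\<^bsub>\<Gamma>\<^esub> h) x) \<le> C))"

text \<open>The open \<open>R\<close>-neighbourhood of a subset.\<close>

definition nbhd :: "'a set \<Rightarrow> ('a \<Rightarrow> 'a \<Rightarrow> real) \<Rightarrow> real \<Rightarrow> 'a set \<Rightarrow> 'a set" where
  "nbhd X d R A = (\<Union>a\<in>A. Metric_space.mball X d a R)"

definition cobounded_action ::
  "('g, 'm) monoid_scheme \<Rightarrow> 'a set \<Rightarrow> ('a \<Rightarrow> 'a \<Rightarrow> real) \<Rightarrow> ('g \<Rightarrow> 'a \<Rightarrow> 'a) \<Rightarrow> bool" where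
  "cobounded_action \<Gamma> X d act \<longleftrightarrow>
     (\<exists>R>0. \<forall>x\<in>X. nbhd X d R ((\<lambda>g. act g x) ` carrier \<Gamma>) = X)"

text \<open>Finiteness is stated separately because the cardinality of an infinite set is \<open>0\<close> in HOL.\<close>

definition proper_action ::
  "('g, 'm) monoid_scheme \<Rightarrow> 'a set \<Rightarrow> ('a \<Rightarrow> 'a \<Rightarrow> real) \<Rightarrow> ('g \<Rightarrow> 'a \<Rightarrow> 'a) \<Rightarrow> bool" where
  "proper_action \<Gamma> X d act \<longleftrightarrow>
     (\<forall>R>0. \<exists>M::nat. M > 0 \<and> (\<forall>x\<in>X. \<forall>y\<in>X.
        finite {g \<in> carrier \<Gamma>. act g ` nbhd X d R {x} \<inter> nbhd X d R {y} \<noteq> {}} \<and>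
        card {g \<in> carrier \<Gamma>. act g ` nbhd X d R {x} \<inter> nbhd X d R {y} \<noteq> {}} \<le> M))"

definition coarse_map ::
  "'a set \<Rightarrow> ('a \<Rightarrow> 'a \<Rightarrow> real) \<Rightarrow> 'b set \<Rightarrow> ('b \<Rightarrow> 'b \<Rightarrow> real) \<Rightarrow> ('a \<Rightarrow> 'b) \<Rightarrow> bool" where
  "coarse_map X dX Y dY f \<longleftrightarrow>
     f \<in> X \<rightarrow> Y \<and>
     (\<forall>B. Metric_space.mbounded Y dY B \<longrightarrow> Metric_space.mbounded X dX {x \<in> X. f x \<in> B}) \<and>
     (\<forall>R>0. \<exists>S>0. \<forall>x1\<in>X. \<forall>x2\<in>X. dX x1 x2 \<le> R \<longrightarrow> dY (f x1) (f x2) \<le> S)"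

definition coarse_equivalence ::
  "'a set \<Rightarrow> ('a \<Rightarrow> 'a \<Rightarrow> real) \<Rightarrow> 'b set \<Rightarrow> ('b \<Rightarrow> 'b \<Rightarrow> real) \<Rightarrow> ('a \<Rightarrow> 'b) \<Rightarrow> bool" where
  "coarse_equivalence X dX Y dY f \<longleftrightarrow>
     coarse_map X dX Y dY f \<and>
     (\<exists>f'. coarse_map Y dY X dX f' \<and>
        (\<exists>K. \<forall>x\<in>X. dX (f' (f x)) x \<le> K) \<and>
        (\<exists>K. \<forall>y\<in>Y. dY (f (f' y)) y \<le> K))"

text \<open>
  \<open>X\<^sup>G\<^sub>k\<close>, where \<open>G\<close> is the underlying set of a group; for a subgroup, restricting
  the coarse action keeps \<open>act\<close> and shrinks \<open>G\<close>.
\<close>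

definition coarse_fixed_set ::
  "'a set \<Rightarrow> ('a \<Rightarrow> 'a \<Rightarrow> real) \<Rightarrow> ('g \<Rightarrow> 'a \<Rightarrow> 'a) \<Rightarrow> 'g set \<Rightarrow> real \<Rightarrow> 'a set" where
  "coarse_fixed_set X d act G k = {x \<in> X. \<forall>g\<in>G. d x (act g x) \<le> k}"

text \<open>
  \<open>Y\<close> is a bounded fixed set \<open>X\<^sup>G\<^sub>b\<^sub>d\<close>. Such a \<open>Y\<close> is not unique, so this is a
  predicate, and the bounded fixed set exists if some \<open>Y\<close> satisfies it.
\<close>

definition is_bounded_fixed_set ::
  "'a set \<Rightarrow> ('a \<Rightarrow> 'a \<Rightarrow> real) \<Rightarrow> ('g \<Rightarrow> 'a \<Rightarrow> 'a) \<Rightarrow> 'g set \<Rightarrow> 'a set \<Rightarrow> bool" where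
  "is_bounded_fixed_set X d act G Y \<longleftrightarrow>
     (\<exists>k0>0. Y \<subseteq> coarse_fixed_set X d act G k0 \<and>
        (\<forall>k\<ge>k0. coarse_equivalence Y d (coarse_fixed_set X d act G k) d (\<lambda>y. y)))"

end

theory Submission
  imports Defs
begin

text \<open>
  Fix a base point \<open>x0\<close>. A point \<open>x\<close> of \<open>X\<^sup>G\<^sub>k\<close> lies near some \<open>\<gamma> x0\<close>, and then every
  \<open>\<gamma>\<^sup>-\<^sup>1 g \<gamma>\<close> with \<open>g \<in> G\<close> moves \<open>x0\<close> by a bounded amount, so by properness
  the conjugation maps \<open>g \<mapsto> \<gamma>\<^sup>-\<^sup>1 g \<gamma>\<close> arising in this way form a finite set for each \<open>k\<close>.
  Let \<open>b\<close> be one of finitely many elements representing these maps, with the same map as \<open>\<gamma>\<close>.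
  Then \<open>c = \<gamma> b\<^sup>-\<^sup>1\<close> centralizes \<open>G\<close>, and \<open>c x0\<close> is near \<open>\<gamma> x0 = c b x0\<close>, hence near \<open>x\<close>.
  Since \<open>g c x0 = c g x0\<close> up to a uniform error, \<open>c x0\<close> is moved by \<open>G\<close> by an amount
  independent of \<open>k\<close>, so \<open>X\<^sup>G\<^sub>k\<close> is within bounded distance of one fixed set \<open>X\<^sup>G\<^sub>k\<^sub>0\<close>.
\<close>

lemma mbounded_subset_iff:
  assumes "Metric_space X d" "Y \<subseteq> X"
  shows "Metric_space.mbounded Y d B \<longleftrightarrow> B \<subseteq> Y \<and> (\<exists>b. \<forall>x\<in>B. \<forall>y\<in>B. d x y \<le> b)"
  using Metric_space.mbounded_alt[OF Metric_space.subspace[OF assms]] .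

text \<open>Moving every point by at most \<open>K\<close> changes distances by at most
  \<open>2 * K\<close>. The two directions of this estimate give the control of distances and the
  boundedness of preimages.\<close>

lemma coarse_map_close_to_id:
  assumes X: "Metric_space X d" and "Y \<subseteq> X" "Z \<subseteq> X"
    and f: "f \<in> Y \<rightarrow> Z" and K: "\<And>y. y \<in> Y \<Longrightarrow> d (f y) y \<le> K"
  shows "coarse_map Y d Z d f"
proof -
  interpret Metric_space X d by fact
  have X_mem: "x \<in> X" "f x \<in> X" if "x \<in> Y" for x
    using that assms by auto
  have upper: "d (f x) (f y) \<le> d x y + 2 * K" if "x \<in> Y" "y \<in> Y" for x y
    using triangle[of "f x" x "f y"] triangle[of x y "f y"] K[of x] K[of y] commute[of y "f y"]
      X_mem that by force
  have lower: "d x y \<le> d (f x) (f y) + 2 * K" if "x \<in> Y" "y \<in> Y" for x y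
    using triangle[of x "f x" y] triangle[of "f x" "f y" y] K[of x] K[of y] commute[of x "f x"]
      X_mem that by force
  have "Metric_space.mbounded Y d {y \<in> Y. f y \<in> B}" if B: "Metric_space.mbounded Z d B" for B
  proof -
    obtain b where b: "\<And>x y. x \<in> B \<Longrightarrow> y \<in> B \<Longrightarrow> d x y \<le> b"
      using B unfolding mbounded_subset_iff[OF X \<open>Z \<subseteq> X\<close>] by blast
    have "d x y \<le> b + 2 * K" if "x \<in> {y \<in> Y. f y \<in> B}" "y \<in> {y \<in> Y. f y \<in> B}" for x y
      using lower[of x y] b[of "f x" "f y"] that by auto
    then show ?thesis
      unfolding mbounded_subset_iff[OF X \<open>Y \<subseteq> X\<close>] by blast
  qed
  moreover have "\<exists>S>0. \<forall>x\<in>Y. \<forall>y\<in>Y. d x y \<le> R \<longrightarrow> d (f x) (f y) \<le> S" if "R > 0" for R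
  \<comment> \<open>If \<open>Y\<close> is empty, \<open>K\<close> may be negative; the absolute
    value keeps the witness positive.\<close>
  proof (intro exI[of _ "R + 2 * \<bar>K\<bar>"] conjI ballI impI)
    show "d (f x) (f y) \<le> R + 2 * \<bar>K\<bar>" if "x \<in> Y" "y \<in> Y" "d x y \<le> R" for x y
      using upper[of x y] that by auto
  qed (use that in auto)
  ultimately show ?thesis
    unfolding coarse_map_def using f by blast
qed

text \<open>A coarse inverse \<open>f\<close> picks a point of \<open>Y\<close> within
  \<open>K\<close>. Composing it with the inclusion on either side gives \<open>f\<close> again,
  which is \<open>K\<close>-close to the identity.\<close>

lemma coarse_equivalence_inclusion:
  assumes "Metric_space X d" "Y \<subseteq> Z" "Z \<subseteq> X"
    and "\<And>z. z \<in> Z \<Longrightarrow> \<exists>y\<in>Y. d y z \<le> K"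
  shows "coarse_equivalence Y d Z d (\<lambda>y. y)"
proof -
  interpret Metric_space X d by fact
  obtain f where f: "\<And>z. z \<in> Z \<Longrightarrow> f z \<in> Y \<and> d (f z) z \<le> K"
    using assms(4) by metis
  have "coarse_map Y d Z d (\<lambda>y. y)"
    using assms(2,3) by (intro coarse_map_close_to_id[OF assms(1), where K = 0]) auto
  moreover have "coarse_map Z d Y d f"
    using assms(2,3) f by (intro coarse_map_close_to_id[OF assms(1), where K = K]) auto
  ultimately show ?thesis
    unfolding coarse_equivalence_def using f assms(2) by blast
qed

lemma (in group) mult_inv_cancel_left:
  assumes "a \<in> carrier G" "b \<in> carrier G"
  shows "a \<otimes> (inv a \<otimes> b) = b"
  using assms by (simp add: m_assoc [symmetric])

text \<open>Inserting \<open>b \<otimes> inv b\<close> after \<open>g\<close> exposes the conjugate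
  of \<open>g\<close> by \<open>b\<close>; exchanging it for the conjugate by \<open>a\<close> moves
  \<open>g\<close> to the front.\<close>

lemma (in group) centralizes_if_conjugation_eq:
  assumes "a \<in> carrier G" "b \<in> carrier G" "g \<in> carrier G"
    and "inv a \<otimes> g \<otimes> a = inv b \<otimes> g \<otimes> b"
  shows "(a \<otimes> inv b) \<otimes> g = g \<otimes> (a \<otimes> inv b)"
proof -
  have "(a \<otimes> inv b) \<otimes> g = a \<otimes> (inv b \<otimes> g \<otimes> b) \<otimes> inv b"
    using assms(1-3) by (simp add: m_assoc)
  also have "\<dots> = a \<otimes> (inv a \<otimes> g \<otimes> a) \<otimes> inv b"
    by (simp add: assms(4))
  also have "\<dots> = g \<otimes> (a \<otimes> inv b)"
    using assms(1-3) by (simp add: m_assoc mult_inv_cancel_left)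
  finally show ?thesis .
qed

text \<open>Properness is applied with both balls centred at \<open>x\<close>: if \<open>g\<close>
  moves \<open>x\<close> only a little, \<open>act g x\<close> lies in the second ball and in the
  image of the first.\<close>

lemma finite_bounded_displacement:
  assumes "Metric_space X d" "proper_action \<Gamma> X d act" "x \<in> X"
    and act: "\<And>g. g \<in> carrier \<Gamma> \<Longrightarrow> act g x \<in> X"
  shows "finite {g \<in> carrier \<Gamma>. d x (act g x) \<le> r}"
proof -
  interpret Metric_space X d by fact
  \<comment> \<open>The radius must be positive, and larger than \<open>r\<close> because the balls
    are open.\<close>
  let ?R = "\<bar>r\<bar> + 1"
  have "?R > 0" by simp
  then have "finite {g \<in> carrier \<Gamma>. act g ` nbhd X d ?R {x} \<inter> nbhd X d ?R {x} \<noteq> {}}"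
    using assms(2,3) unfolding proper_action_def by blast
  moreover have "act g x \<in> act g ` nbhd X d ?R {x} \<inter> nbhd X d ?R {x}"
    if "g \<in> carrier \<Gamma>" "d x (act g x) \<le> r" for g
    using that act[of g] \<open>x \<in> X\<close> by (auto simp: nbhd_def)
  ultimately show ?thesis
    by (elim finite_subset[rotated]) auto
qed

text \<open>Only \<open>K\<close> may depend on \<open>k\<close>, through the finite set of
  representatives; the bound \<open>L * D + 3 * C\<close> does not.\<close>

lemma coarse_fixed_set_near:
  fixes \<Gamma> :: "('g, 'm) monoid_scheme"
  assumes "Metric_space X d" "group \<Gamma>" "proper_action \<Gamma> X d act"
    and "G \<subseteq> carrier \<Gamma>" "finite G" "x0 \<in> X" "L > 0" "C > 0"
    and quasi_isom: "\<And>g. g \<in> carrier \<Gamma> \<Longrightarrow> quasi_isometry L C X d X d (act g)"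
    and assoc: "\<And>g h x. g \<in> carrier \<Gamma> \<Longrightarrow> h \<in> carrier \<Gamma> \<Longrightarrow> x \<in> X \<Longrightarrow>
      d (act g (act h x)) (act (g \<otimes>\<^bsub>\<Gamma>\<^esub> h) x) \<le> C"
    and dense: "\<And>x. x \<in> X \<Longrightarrow> \<exists>\<gamma>\<in>carrier \<Gamma>. d (act \<gamma> x0) x \<le> R"
    and D: "\<And>g. g \<in> G \<Longrightarrow> d x0 (act g x0) \<le> D"
  shows "\<exists>K. \<forall>x\<in>coarse_fixed_set X d act G k.
    \<exists>y\<in>coarse_fixed_set X d act G (L * D + 3 * C). d y x \<le> K"
proof -
  interpret Metric_space X d by fact
  interpret group \<Gamma> by fact
  have act_closed: "act g x \<in> X" if "g \<in> carrier \<Gamma>" "x \<in> X" for g x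
    using quasi_isom that unfolding quasi_isometry_def by blast
  have upper: "d (act g x) (act g y) \<le> L * d x y + C"
    if "g \<in> carrier \<Gamma>" "x \<in> X" "y \<in> X" for g x y
    using quasi_isom that unfolding quasi_isometry_def by blast
  have lower: "d x y \<le> L * (d (act g x) (act g y) + C)"
    if "g \<in> carrier \<Gamma>" "x \<in> X" "y \<in> X" for g x y
  proof -
    have "(1 / L) * d x y - C \<le> d (act g x) (act g y)"
      using quasi_isom that unfolding quasi_isometry_def by blast
    then show ?thesis
      using \<open>L > 0\<close> by (simp add: field_simps)
  qed
  note GC = subsetD[OF \<open>G \<subseteq> carrier \<Gamma>\<close>]

  \<comment> \<open>Restriction to \<open>G\<close> places these maps in an extensional function
    space, which is finite when \<open>G\<close> and the target are.\<close>
  define conj where "conj \<gamma> = (\<lambda>g\<in>G. inv\<^bsub>\<Gamma>\<^esub> \<gamma> \<otimes>\<^bsub>\<Gamma>\<^esub> g \<otimes>\<^bsub>\<Gamma>\<^esub> \<gamma>)" for \<gamma>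
  define F where "F = {h \<in> carrier \<Gamma>. d x0 (act h x0) \<le> L * (L * R + k + R + 4 * C)}"
  define A where "A = {\<gamma> \<in> carrier \<Gamma>. conj \<gamma> \<in> G \<rightarrow>\<^sub>E F}"
  have "finite F"
    unfolding F_def using assms(1,3) \<open>x0 \<in> X\<close> act_closed by (intro finite_bounded_displacement) auto
  then have "finite (conj ` A)"
    using \<open>finite G\<close> by (intro finite_subset[OF _ finite_PiE[of G "\<lambda>_. F"]]) (auto simp: A_def)
  then obtain B where B: "B \<subseteq> A" "finite B" "conj ` A = conj ` B"
    using finite_subset_image by (metis order_refl)
  \<comment> \<open>If \<open>B\<close> is empty, \<open>M\<close> is unspecified, but it is only
    ever compared with elements of \<open>B\<close>.\<close>
  define M where "M = Max ((\<lambda>b. d x0 (act b x0)) ` B)"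
  have M: "d x0 (act b x0) \<le> M" if "b \<in> B" for b
    unfolding M_def using that B by (intro Max_ge) auto

  have "\<exists>y\<in>coarse_fixed_set X d act G (L * D + 3 * C). d y x \<le> L * M + 2 * C + R"
    if x: "x \<in> coarse_fixed_set X d act G k" for x
  proof -
    have "x \<in> X" and fixed: "\<And>g. g \<in> G \<Longrightarrow> d x (act g x) \<le> k"
      using x by (auto simp: coarse_fixed_set_def)
    obtain \<gamma> where \<gamma>: "\<gamma> \<in> carrier \<Gamma>" "d (act \<gamma> x0) x \<le> R"
      using dense \<open>x \<in> X\<close> by blast
    have "inv\<^bsub>\<Gamma>\<^esub> \<gamma> \<otimes>\<^bsub>\<Gamma>\<^esub> g \<otimes>\<^bsub>\<Gamma>\<^esub> \<gamma> \<in> F" if "g \<in> G" for g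
    proof -
      define h where "h = inv\<^bsub>\<Gamma>\<^esub> \<gamma> \<otimes>\<^bsub>\<Gamma>\<^esub> g \<otimes>\<^bsub>\<Gamma>\<^esub> \<gamma>"
      have g: "g \<in> carrier \<Gamma>" and h: "h \<in> carrier \<Gamma>"
        using GC that \<gamma> by (auto simp: h_def)
      have eq: "\<gamma> \<otimes>\<^bsub>\<Gamma>\<^esub> h = g \<otimes>\<^bsub>\<Gamma>\<^esub> \<gamma>"
        using g \<gamma> by (simp add: h_def m_assoc mult_inv_cancel_left)
      define p where "p = act \<gamma> x0"
      define q where "q = act g p"
      define r where "r = act (g \<otimes>\<^bsub>\<Gamma>\<^esub> \<gamma>) x0"
      define s where "s = act \<gamma> (act h x0)"
      have mem: "p \<in> X" "q \<in> X" "r \<in> X" "s \<in> X" "act g x \<in> X"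
        using g h \<gamma> \<open>x \<in> X\<close> \<open>x0 \<in> X\<close> by (auto simp: p_def q_def r_def s_def intro!: act_closed)
      have "d x p \<le> R"
        using \<gamma> commute by (simp add: p_def)
      then have "L * d x p \<le> L * R"
        using \<open>L > 0\<close> by simp
      then have "d (act g x) q \<le> L * R + C"
        using upper[OF g \<open>x \<in> X\<close> mem(1)] by (simp add: q_def)
      moreover have "d q r \<le> C"
        using assoc[OF g \<gamma>(1) \<open>x0 \<in> X\<close>] by (simp add: p_def q_def r_def)
      moreover have "d r s \<le> C"
        using assoc[OF \<gamma>(1) h \<open>x0 \<in> X\<close>] by (simp add: r_def s_def eq commute)
      \<comment> \<open>The summands follow the path \<open>p\<close>, \<open>x\<close>,
        \<open>act g x\<close>, \<open>q\<close>, \<open>r\<close>, \<open>s\<close>. Undoing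
        \<open>act \<gamma>\<close> by \<open>lower\<close> then adds one more \<open>C\<close> and
        the factor \<open>L\<close>, whence the bound in \<open>F\<close>.\<close>
      ultimately have "d p s \<le> R + k + (L * R + C) + C + C"
        using triangle[of p x s] triangle[of x "act g x" s] triangle[of "act g x" q s]
          triangle[of q r s] fixed[OF that] mem \<open>x \<in> X\<close> \<gamma>(2)
        by (simp add: p_def)
      then have "L * (d p s + C) \<le> L * (L * R + k + R + 4 * C)"
        using \<open>L > 0\<close> by simp
      then have "d x0 (act h x0) \<le> L * (L * R + k + R + 4 * C)"
        using lower[OF \<gamma>(1) \<open>x0 \<in> X\<close> act_closed[OF h \<open>x0 \<in> X\<close>]] by (simp add: p_def s_def)
      then show ?thesis
        using h by (simp add: F_def h_def)
    qed
    then have "\<gamma> \<in> A"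
      using \<gamma> by (auto simp: A_def conj_def)
    then obtain b where b: "b \<in> B" "conj \<gamma> = conj b"
      using B(3) by (metis (no_types, lifting) imageE imageI)
    have bc: "b \<in> carrier \<Gamma>"
      using b B by (auto simp: A_def)
    define c where "c = \<gamma> \<otimes>\<^bsub>\<Gamma>\<^esub> inv\<^bsub>\<Gamma>\<^esub> b"
    have c: "c \<in> carrier \<Gamma>" "c \<otimes>\<^bsub>\<Gamma>\<^esub> b = \<gamma>"
      using \<gamma> bc by (auto simp: c_def m_assoc)
    have central: "c \<otimes>\<^bsub>\<Gamma>\<^esub> g = g \<otimes>\<^bsub>\<Gamma>\<^esub> c" if "g \<in> G" for g
    proof -
      have "conj \<gamma> g = conj b g"
        using b by simp
      then show ?thesis
        unfolding c_def using that GC \<gamma> bc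
        by (intro centralizes_if_conjugation_eq) (auto simp: conj_def)
    qed
    have "act c x0 \<in> X"
      using c \<open>x0 \<in> X\<close> act_closed by simp
    \<comment> \<open>The path runs through \<open>c (g x0)\<close> and
      \<open>(c g) x0 = (g c) x0\<close>, at costs \<open>L * D + C\<close>, \<open>C\<close> and
      \<open>C\<close>.\<close>
    moreover have "d (act c x0) (act g (act c x0)) \<le> L * D + 3 * C" if "g \<in> G" for g
    proof -
      note g = GC[OF that]
      define p where "p = act c (act g x0)"
      define q where "q = act (c \<otimes>\<^bsub>\<Gamma>\<^esub> g) x0"
      have mem: "p \<in> X" "q \<in> X" "act g (act c x0) \<in> X" "act g x0 \<in> X"
        using c g \<open>x0 \<in> X\<close> by (auto simp: p_def q_def intro!: act_closed)
      have "L * d x0 (act g x0) \<le> L * D"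
        using D[OF that] \<open>L > 0\<close> by simp
      then have "d (act c x0) p \<le> L * D + C"
        using upper[OF c(1) \<open>x0 \<in> X\<close> mem(4)] by (simp add: p_def)
      moreover have "d p q \<le> C"
        using assoc[OF c(1) g \<open>x0 \<in> X\<close>] by (simp add: p_def q_def)
      moreover have "d q (act g (act c x0)) \<le> C"
        using assoc[OF g c(1) \<open>x0 \<in> X\<close>] by (simp add: q_def central[OF that] commute)
      ultimately show ?thesis
        using triangle[of "act c x0" p "act g (act c x0)"] triangle[of p q "act g (act c x0)"]
          mem \<open>act c x0 \<in> X\<close> by simp
    qed
    ultimately have "act c x0 \<in> coarse_fixed_set X d act G (L * D + 3 * C)"
      by (simp add: coarse_fixed_set_def)
    \<comment> \<open>The path runs through \<open>c (b x0)\<close> and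
      \<open>(c b) x0 = \<gamma> x0\<close>, at costs \<open>L * M + C\<close>, \<open>C\<close> and
      \<open>R\<close>.\<close>
    moreover have "d (act c x0) x \<le> L * M + 2 * C + R"
    proof -
      have mem: "act b x0 \<in> X" "act c (act b x0) \<in> X" "act \<gamma> x0 \<in> X"
        using bc c \<gamma> \<open>x0 \<in> X\<close> by (auto intro!: act_closed)
      have "L * d x0 (act b x0) \<le> L * M"
        using M[OF b(1)] \<open>L > 0\<close> by simp
      then have "d (act c x0) (act c (act b x0)) \<le> L * M + C"
        using upper[OF c(1) \<open>x0 \<in> X\<close> mem(1)] by simp
      moreover have "d (act c (act b x0)) (act \<gamma> x0) \<le> C"
        using assoc[OF c(1) bc \<open>x0 \<in> X\<close>] by (simp add: c(2))
      ultimately show ?thesis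
        using triangle[of "act c x0" "act c (act b x0)" x] triangle[of "act c (act b x0)" "act \<gamma> x0" x]
          mem \<open>act c x0 \<in> X\<close> \<open>x \<in> X\<close> \<gamma>(2) by simp
    qed
    ultimately show ?thesis by blast
  qed
  then show ?thesis by blast
qed

theorem theorem4p7:
  fixes X :: "'a set" and d :: "'a \<Rightarrow> 'a \<Rightarrow> real"
    and \<Gamma> :: "('g, 'm) monoid_scheme" and act :: "'g \<Rightarrow> 'a \<Rightarrow> 'a"
    and G :: "'g set"
  assumes "proper_metric_space X d" and "geodesic_metric_space X d"
    and "group \<Gamma>"
    and "coarse_action \<Gamma> X d act"
    and "proper_action \<Gamma> X d act" and "cobounded_action \<Gamma> X d act"
    and "subgroup G \<Gamma>" and "finite G"
  shows "\<exists>Y. is_bounded_fixed_set X d act G Y"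
proof -
  have X: "Metric_space X d"
    using assms(1) by (simp add: proper_metric_space_def)
  interpret Metric_space X d by (fact X)
  have GC: "G \<subseteq> carrier \<Gamma>"
    using assms(7) by (rule subgroup.subset)
  obtain L C where LC: "L > 0" "C > 0"
    and qi: "\<And>g. g \<in> carrier \<Gamma> \<Longrightarrow> quasi_isometry L C X d X d (act g)"
    and assoc: "\<And>g h x. g \<in> carrier \<Gamma> \<Longrightarrow> h \<in> carrier \<Gamma> \<Longrightarrow> x \<in> X \<Longrightarrow>
      d (act g (act h x)) (act (g \<otimes>\<^bsub>\<Gamma>\<^esub> h) x) \<le> C"
    using assms(4) unfolding coarse_action_def by blast
  obtain R where R: "\<And>x. x \<in> X \<Longrightarrow> nbhd X d R ((\<lambda>g. act g x) ` carrier \<Gamma>) = X"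
    using assms(6) unfolding cobounded_action_def by blast
  have "\<exists>k0>0. \<forall>k. \<exists>K. \<forall>x\<in>coarse_fixed_set X d act G k.
    \<exists>y\<in>coarse_fixed_set X d act G k0. d y x \<le> K"
  \<comment> \<open>The empty space has no base point, but there any positive \<open>k0\<close>
    works.\<close>
  proof (cases "X = {}")
    case True
    then show ?thesis
      by (intro exI[of _ 1]) (simp add: coarse_fixed_set_def)
  next
    case False
    then obtain x0 where x0: "x0 \<in> X" by blast
    have dense: "\<exists>\<gamma>\<in>carrier \<Gamma>. d (act \<gamma> x0) x \<le> R" if "x \<in> X" for x
    proof -
      have "x \<in> nbhd X d R ((\<lambda>g. act g x0) ` carrier \<Gamma>)"
        using R[OF x0] that by simp
      then show ?thesis
        by (auto simp: nbhd_def intro: less_imp_le)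
    qed
    \<comment> \<open>Inserting \<open>0\<close> makes \<open>D\<close> nonnegative at once, so that
      \<open>k0 = L * D + 3 * C\<close> is positive.\<close>
    define D where "D = Max (insert 0 ((\<lambda>g. d x0 (act g x0)) ` G))"
    have D: "d x0 (act g x0) \<le> D" if "g \<in> G" for g
      unfolding D_def using that assms(8) by (intro Max_ge) auto
    have "D \<ge> 0"
      unfolding D_def using assms(8) by (intro Max_ge) auto
    then have "L * D + 3 * C > 0"
      using LC by (intro add_nonneg_pos) auto
    with coarse_fixed_set_near[OF X assms(3,5) GC assms(8) x0 LC qi assoc dense D]
    show ?thesis by blast
  qed
  then obtain k0 where "k0 > 0"
    and near: "\<And>k. \<exists>K. \<forall>x\<in>coarse_fixed_set X d act G k.
      \<exists>y\<in>coarse_fixed_set X d act G k0. d y x \<le> K"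
    by blast
  have "coarse_equivalence (coarse_fixed_set X d act G k0) d (coarse_fixed_set X d act G k) d (\<lambda>y. y)"
    if "k \<ge> k0" for k
  proof -
    obtain K where "\<And>x. x \<in> coarse_fixed_set X d act G k \<Longrightarrow>
      \<exists>y\<in>coarse_fixed_set X d act G k0. d y x \<le> K"
      using near by blast
    \<comment> \<open>The assumption \<open>k \<ge> k0\<close> supplies the inclusion of the smaller
      fixed set in the larger one.\<close>
    with that show ?thesis
      by (intro coarse_equivalence_inclusion[OF X, where K = K]) (force simp: coarse_fixed_set_def)+
  qed
  with \<open>k0 > 0\<close> show ?thesis
    unfolding is_bounded_fixed_set_def by blast
qed

end
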